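(* Consider the problem $\min_{x\in Q}\{f_0(x):\ F(x)=f(x)+\psi(x)\le0\}$, $f(x)=\max_{1\le i\le m}f_i(x)$, with an optimal solution $x_*$. Let $\{x_k\},\{y_k\}$ be generated by the Double-Step Subgradient Method (described in the context) with $h_k=\sqrt{2D}\,\tau_k$, $k\ge0$, where the sequence $\{\tau_k\}_{k\ge0}$ satisfies $\tau_k\ge\tau_{k+1}>0$ for all $k\ge0$ and $\sum_{k=0}^\infty\tau_k^2=+\infty$. Let $a(\cdot)$ be the divergence delay of $\{\tau_k\}$. Then for any $N\ge1+a(0)$ the number $k(N)=\max\{k\ge0:\ k+a(k)\le N-1\}\ge0$ is well defined, and $$\delta_N^*:=\min_{k\in\mathcal{F}_N}\delta_k\ <\ h_{k(N)}$$ (with the minimum over the empty set equal to $+\infty$). Moreover, if all functions $f_i$, $i=1,\dots,m$, have Hölder-continuous gradients on $Q$ with parameter $\nu\in[0,1]$ and constant $L_\nu>0$, in the sense that $f_i(y)\le f_i(x)+\langle f_i'(x),y-x\rangle+\frac{L_\nu}{1+\nu}\|y-x\|^{1+\nu}$ for all $x,y\in Q$, then for any $k\in\mathcal{F}_N$ $$F(y_k)\ \le\ \frac{L_\nu}{1+\nu}\,h_{k(N)}^{1+\nu}.$$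
   Context: $\mathbb{E}$ is a finite-dimensional real vector space with dual $\mathbb{E}^*$, $\langle s,x\rangle$ is the value of $s\in\mathbb{E}^*$ at $x$, and $\|\cdot\|$ is an arbitrary norm on $\mathbb{E}$. Problem data: $\psi$ is a closed convex function, $Q\subseteq\mathrm{dom}\,\psi$ is a closed convex set, and $f_0,\dots,f_m$ are closed and convex on $\mathrm{dom}\,\psi$. For $1\le i\le m$, $f_i'(x)$ is a fixed subgradient of $f_i$ at $x\in Q$. For $x\in Q$, $f_0'(x)\in\mathbb{E}^*\setminus\{0\}$ is a fixed vector such that for all $y\in\mathbb{E}$: $\langle f_0'(x),y-x\rangle\ge0\Rightarrow f_0(y)\ge f_0(x)$ (with $f_0=+\infty$ outside its domain); e.g. a nonzero subgradient. Prox-function: $d$ is continuously differentiable on a convex open domain $\mathrm{dom}\,d\supseteq Q$ with $d(y)\ge d(x)+\langle\nabla d(x),y-x\rangle+\frac12\|y-x\|^2$. Bregman distance: $\beta_d(x,y)=d(y)-d(x)-\langle\nabla d(x),y-x\rangle$. The constant $D$ satisfies $\beta_d(x,y)<D$ for all $x,y\in Q$. Feasibility step $\hat T(x_k)$ at $x_k\in Q$: with $\ell_{\bar x}(x)=\max_{1\le i\le m}[f_i(\bar x)+\langle f_i'(\bar x),x-\bar x\rangle]$, put $$\hat\varphi_{\bar x}(\lambda)=\max_{x\in Q}\{\lambda[F(\bar x)-\ell_{\bar x}(x)-\psi(x)]-\beta_d(\bar x,x)\},\quad\lambda\ge0,$$ with unique maximizer $\hat T_{\bar x}(\lambda)$;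 choose $\lambda_k\in\arg\min_{\lambda\ge0}\{\hat\varphi_{x_k}(\lambda)-\lambda F(x_k)\}$ and set $\hat T(x_k)=\hat T_{x_k}(\lambda_k)$. Optimality step $T(y_k)$ at $y_k\in Q$: put $$\varphi_{\bar x}(\lambda)=\max_{x\in Q}\{\lambda\langle f_0'(\bar x),\bar x-x\rangle-\beta_d(\bar x,x)\},\quad\lambda\ge0,$$ with maximizer $T_{\bar x}(\lambda)$; find $\lambda_k>0$ with $\varphi_{y_k}(\lambda_k)=\frac12h_k^2$ and set $T(y_k)=T_{y_k}(\lambda_k)$. All the required values $\lambda_k$ are assumed to exist. Double-Step Subgradient Method: choose $x_0\in Q$ and positive $\{h_k\}_{k\ge0}$. For $k\ge0$: (1) compute $y_k=\hat T(x_k)$. (2) If $\beta_d(x_k,y_k)\ge\frac12h_k^2$, then (2a) $x_{k+1}=y_k$; else (2b) $x_{k+1}=T(y_k)$. Divergence delay: $a(k)\ge0$ is the minimal nonnegative integer such that $\sum_{i=k}^{k+a(k)}\tau_i^2\ge1$. $\mathcal{F}_N$ is the set of $k$ with $k(N)\le k\le N-1$ for which step (2b) was performed at iteration $k$. For $k\in\mathcal{F}_N$, with $d_k=\frac{y_k-x_{k+1}}{\|y_k-x_{k+1}\|}$, $$\delta_k=\frac{\langle f_0'(y_k),y_k-x_*\rangle}{\langle f_0'(y_k),d_k\rangle}.$$ *)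

theory Defs
  imports "HOL-Analysis.Analysis"
begin

(* Extended-valued functions are given by an effective domain together with a real-valued
   function whose values outside that domain are irrelevant.  The dual space is the type
   'a \<Rightarrow>\<^sub>L real, which in finite dimension contains every linear functional. *)

definition closed_convex_on :: "'a::real_normed_vector set \<Rightarrow> ('a \<Rightarrow> real) \<Rightarrow> bool" where
  "closed_convex_on S f \<longleftrightarrow> convex_on S f \<and> closed (epigraph S f)"

definition is_subgradient ::
    "'a::real_normed_vector set \<Rightarrow> ('a \<Rightarrow> real) \<Rightarrow> 'a \<Rightarrow> ('a \<Rightarrow>\<^sub>L real) \<Rightarrow> bool" where
  "is_subgradient S f x g \<longleftrightarrow> x \<in> S \<and> (\<forall>y\<in>S. f y \<ge> f x + blinfun_apply g (y - x))"

definition bregman ::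
    "('a::real_normed_vector \<Rightarrow> real) \<Rightarrow> ('a \<Rightarrow> 'a \<Rightarrow>\<^sub>L real) \<Rightarrow> 'a \<Rightarrow> 'a \<Rightarrow> real" where
  "bregman d gd x y = d y - d x - blinfun_apply (gd x) (y - x)"

definition prox_function ::
    "'a::real_normed_vector set \<Rightarrow> ('a \<Rightarrow> real) \<Rightarrow> ('a \<Rightarrow> 'a \<Rightarrow>\<^sub>L real) \<Rightarrow> bool" where
  "prox_function U d gd \<longleftrightarrow>
     open U \<and> convex U \<and>
     (\<forall>x\<in>U. (d has_derivative blinfun_apply (gd x)) (at x)) \<and> continuous_on U gd \<and>
     (\<forall>x\<in>U. \<forall>y\<in>U. d y \<ge> d x + blinfun_apply (gd x) (y - x) + 1/2 * (norm (y - x))\<^sup>2)"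

(* The constraints have the indices 1..m; index 0 is the objective function. *)
definition constr ::
    "nat \<Rightarrow> (nat \<Rightarrow> 'a::real_normed_vector \<Rightarrow> real) \<Rightarrow> ('a \<Rightarrow> real) \<Rightarrow> 'a \<Rightarrow> real" where
  "constr m f \<psi> x = Max ((\<lambda>i. f i x) ` {1..m}) + \<psi> x"

definition lin_model ::
    "nat \<Rightarrow> (nat \<Rightarrow> 'a::real_normed_vector \<Rightarrow> real) \<Rightarrow> (nat \<Rightarrow> 'a \<Rightarrow> 'a \<Rightarrow>\<^sub>L real) \<Rightarrow>
     'a \<Rightarrow> 'a \<Rightarrow> real" where
  "lin_model m f f' xb x = Max ((\<lambda>i. f i xb + blinfun_apply (f' i xb) (x - xb)) ` {1..m})"

definition is_solution ::
    "'a::real_normed_vector set \<Rightarrow> nat \<Rightarrow> (nat \<Rightarrow> 'a \<Rightarrow> real) \<Rightarrow> ('a \<Rightarrow> real) \<Rightarrow> 'a \<Rightarrow> bool" where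
  "is_solution Q m f \<psi> xs \<longleftrightarrow> is_arg_min (f 0) (\<lambda>x. x \<in> Q \<and> constr m f \<psi> x \<le> 0) xs"

definition feas_obj ::
    "nat \<Rightarrow> (nat \<Rightarrow> 'a::real_normed_vector \<Rightarrow> real) \<Rightarrow> (nat \<Rightarrow> 'a \<Rightarrow> 'a \<Rightarrow>\<^sub>L real) \<Rightarrow> ('a \<Rightarrow> real) \<Rightarrow>
     ('a \<Rightarrow> real) \<Rightarrow> ('a \<Rightarrow> 'a \<Rightarrow>\<^sub>L real) \<Rightarrow> 'a \<Rightarrow> real \<Rightarrow> 'a \<Rightarrow> real" where
  "feas_obj m f f' \<psi> d gd xb l x =
     l * (constr m f \<psi> xb - lin_model m f f' xb x - \<psi> x) - bregman d gd xb x"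

(* Under the standing assumptions the objective is bounded above on Q and, for nonnegative l,
   attains its supremum there, so this SUP (and the one in opt_value) is a maximum. *)
definition feas_value ::
    "'a::real_normed_vector set \<Rightarrow> nat \<Rightarrow> (nat \<Rightarrow> 'a \<Rightarrow> real) \<Rightarrow> (nat \<Rightarrow> 'a \<Rightarrow> 'a \<Rightarrow>\<^sub>L real) \<Rightarrow>
     ('a \<Rightarrow> real) \<Rightarrow> ('a \<Rightarrow> real) \<Rightarrow> ('a \<Rightarrow> 'a \<Rightarrow>\<^sub>L real) \<Rightarrow> 'a \<Rightarrow> real \<Rightarrow> real" where
  "feas_value Q m f f' \<psi> d gd xb l = (SUP x\<in>Q. feas_obj m f f' \<psi> d gd xb l x)"

definition feas_step ::
    "'a::real_normed_vector set \<Rightarrow> nat \<Rightarrow> (nat \<Rightarrow> 'a \<Rightarrow> real) \<Rightarrow> (nat \<Rightarrow> 'a \<Rightarrow> 'a \<Rightarrow>\<^sub>L real) \<Rightarrow>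
     ('a \<Rightarrow> real) \<Rightarrow> ('a \<Rightarrow> real) \<Rightarrow> ('a \<Rightarrow> 'a \<Rightarrow>\<^sub>L real) \<Rightarrow> 'a \<Rightarrow> 'a \<Rightarrow> bool" where
  "feas_step Q m f f' \<psi> d gd xb y \<longleftrightarrow>
     (\<exists>l. is_arg_min (\<lambda>l. feas_value Q m f f' \<psi> d gd xb l - l * constr m f \<psi> xb) (\<lambda>l. 0 \<le> l) l \<and>
          is_arg_max (feas_obj m f f' \<psi> d gd xb l) (\<lambda>x. x \<in> Q) y)"

definition opt_obj ::
    "('a::real_normed_vector \<Rightarrow> 'a \<Rightarrow>\<^sub>L real) \<Rightarrow> ('a \<Rightarrow> real) \<Rightarrow> ('a \<Rightarrow> 'a \<Rightarrow>\<^sub>L real) \<Rightarrow>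
     'a \<Rightarrow> real \<Rightarrow> 'a \<Rightarrow> real" where
  "opt_obj g d gd xb l x = l * blinfun_apply (g xb) (xb - x) - bregman d gd xb x"

definition opt_value ::
    "'a::real_normed_vector set \<Rightarrow> ('a \<Rightarrow> 'a \<Rightarrow>\<^sub>L real) \<Rightarrow> ('a \<Rightarrow> real) \<Rightarrow> ('a \<Rightarrow> 'a \<Rightarrow>\<^sub>L real) \<Rightarrow>
     'a \<Rightarrow> real \<Rightarrow> real" where
  "opt_value Q g d gd xb l = (SUP x\<in>Q. opt_obj g d gd xb l x)"

definition opt_step ::
    "'a::real_normed_vector set \<Rightarrow> ('a \<Rightarrow> 'a \<Rightarrow>\<^sub>L real) \<Rightarrow> ('a \<Rightarrow> real) \<Rightarrow> ('a \<Rightarrow> 'a \<Rightarrow>\<^sub>L real) \<Rightarrow>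
     real \<Rightarrow> 'a \<Rightarrow> 'a \<Rightarrow> bool" where
  "opt_step Q g d gd h y x \<longleftrightarrow>
     (\<exists>l>0. opt_value Q g d gd y l = 1/2 * h\<^sup>2 \<and>
            is_arg_max (opt_obj g d gd y l) (\<lambda>z. z \<in> Q) x)"

definition double_step_method ::
    "'a::real_normed_vector set \<Rightarrow> nat \<Rightarrow> (nat \<Rightarrow> 'a \<Rightarrow> real) \<Rightarrow> (nat \<Rightarrow> 'a \<Rightarrow> 'a \<Rightarrow>\<^sub>L real) \<Rightarrow>
     ('a \<Rightarrow> real) \<Rightarrow> ('a \<Rightarrow> real) \<Rightarrow> ('a \<Rightarrow> 'a \<Rightarrow>\<^sub>L real) \<Rightarrow> (nat \<Rightarrow> real) \<Rightarrow>
     (nat \<Rightarrow> 'a) \<Rightarrow> (nat \<Rightarrow> 'a) \<Rightarrow> bool" where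
  "double_step_method Q m f f' \<psi> d gd h x y \<longleftrightarrow>
     x 0 \<in> Q \<and>
     (\<forall>k. feas_step Q m f f' \<psi> d gd (x k) (y k) \<and>
          (if bregman d gd (x k) (y k) \<ge> 1/2 * (h k)\<^sup>2
           then x (Suc k) = y k
           else opt_step Q (f' 0) d gd (h k) (y k) (x (Suc k))))"

definition divergence_delay :: "(nat \<Rightarrow> real) \<Rightarrow> nat \<Rightarrow> nat" where
  "divergence_delay \<tau> k = (LEAST a. (\<Sum>i=k..k + a. (\<tau> i)\<^sup>2) \<ge> 1)"

definition delay_set :: "(nat \<Rightarrow> real) \<Rightarrow> nat \<Rightarrow> nat set" where
  "delay_set \<tau> N = {k. k + divergence_delay \<tau> k \<le> N - 1}"

definition delay_index :: "(nat \<Rightarrow> real) \<Rightarrow> nat \<Rightarrow> nat" where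
  "delay_index \<tau> N = Max (delay_set \<tau> N)"

(* An iteration performs the optimality step exactly when the test on the Bregman distance
   in double_step_method fails. *)
definition opt_iterations ::
    "('a::real_normed_vector \<Rightarrow> real) \<Rightarrow> ('a \<Rightarrow> 'a \<Rightarrow>\<^sub>L real) \<Rightarrow> (nat \<Rightarrow> real) \<Rightarrow>
     (nat \<Rightarrow> real) \<Rightarrow> (nat \<Rightarrow> 'a) \<Rightarrow> (nat \<Rightarrow> 'a) \<Rightarrow> nat \<Rightarrow> nat set" where
  "opt_iterations d gd \<tau> h x y N =
     {k \<in> {delay_index \<tau> N..N - 1}. \<not> bregman d gd (x k) (y k) \<ge> 1/2 * (h k)\<^sup>2}"

definition localization ::
    "('a::real_normed_vector \<Rightarrow> 'a \<Rightarrow>\<^sub>L real) \<Rightarrow> 'a \<Rightarrow> (nat \<Rightarrow> 'a) \<Rightarrow> (nat \<Rightarrow> 'a) \<Rightarrow> nat \<Rightarrow> real" where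
  "localization g xs x y k =
     blinfun_apply (g (y k)) (y k - xs) /
     blinfun_apply (g (y k)) ((y k - x (Suc k)) /\<^sub>R norm (y k - x (Suc k)))"

definition hoelder_gradient ::
    "'a::real_normed_vector set \<Rightarrow> ('a \<Rightarrow> real) \<Rightarrow> ('a \<Rightarrow> 'a \<Rightarrow>\<^sub>L real) \<Rightarrow> real \<Rightarrow> real \<Rightarrow> bool" where
  "hoelder_gradient Q f g \<nu> L \<longleftrightarrow>
     (\<forall>x\<in>Q. \<forall>y\<in>Q.
        f y \<le> f x + blinfun_apply (g x) (y - x) + L / (1 + \<nu>) * norm (y - x) powr (1 + \<nu>))"

end

theory Submission
  imports Defs
begin

text \<open>
  The three-point inequality for Bregman distances turns both steps of the method into descent
  estimates for \<open>\<beta>\<^sub>d(x\<^sub>k, x\<^sub>*)\<close>. Optimality of the multiplier in the feasibility step yields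
  complementary slackness for the model \<open>\<ell> + \<psi>\<close>, so that step never increases the distance and
  decreases it by \<open>\<beta>\<^sub>d(x\<^sub>k, y\<^sub>k)\<close>; the optimality step decreases it by \<open>h\<^sub>k\<^sup>2/2\<close> as long as
  \<open>\<delta>\<^sub>k \<ge> h\<^sub>k\<close>. If all \<open>\<delta>\<^sub>k\<close> were at least \<open>h\<^bsub>k(N)\<^esub>\<close>, the total decrease from \<open>k(N)\<close> to \<open>N\<close>
  would be at least \<open>D\<close>, exhausting the initial distance, which is less than \<open>D\<close>.
\<close>

section \<open>Bregman distances and the three-point inequality\<close>

lemma bregman_self [simp]: "bregman d gd x x = 0"
  by (simp add: bregman_def)

lemma bregman_three_point_eq:
  "bregman d gd x z - bregman d gd x y - bregman d gd y z = blinfun_apply (gd y - gd x) (z - y)"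
  by (simp add: bregman_def blinfun.diff_left blinfun.diff_right)

lemma prox_function_bregman_ge:
  assumes "prox_function U d gd" "x \<in> U" "y \<in> U"
  shows "bregman d gd x y \<ge> 1/2 * (norm (y - x))\<^sup>2"
  using assms by (fastforce simp: prox_function_def bregman_def)

lemma prox_function_bregman_nonneg:
  assumes "prox_function U d gd" "x \<in> U" "y \<in> U"
  shows "bregman d gd x y \<ge> 0"
  by (rule order_trans[OF _ prox_function_bregman_ge[OF assms]]) simp

text \<open>Compare \<open>y\<close> with \<open>y + t (z - y)\<close>, divide by \<open>t\<close>
  and let \<open>t\<close> tend to 0 from the right: convexity bounds the change of \<open>H\<close>
  by a chord, so only \<open>d\<close> is differentiated. The resulting first-order condition is the
  claim, by the three-point identity.\<close>

lemma bregman_three_point: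
  assumes prox: "prox_function U d gd" and QU: "Q \<subseteq> U"
    and H: "convex_on Q H"
    and y: "y \<in> Q" and z: "z \<in> Q"
    and min: "\<And>w. w \<in> Q \<Longrightarrow> H y + bregman d gd x y \<le> H w + bregman d gd x w"
  shows "H y + bregman d gd x y + bregman d gd y z \<le> H z + bregman d gd x z"
proof -
  let ?q = "\<lambda>t. (d (y + t *\<^sub>R (z - y)) - d y) / t"
  have "(d has_derivative blinfun_apply (gd y)) (at (y + 0 *\<^sub>R (z - y)))"
    using prox y QU by (auto simp: prox_function_def)
  then have "((\<lambda>t. d (y + t *\<^sub>R (z - y))) has_derivative
      (\<lambda>t. blinfun_apply (gd y) (t *\<^sub>R (z - y)))) (at 0)"
    by (rule has_derivative_compose[rotated]) (auto intro!: derivative_eq_intros)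
  then have "((\<lambda>t. d (y + t *\<^sub>R (z - y))) has_real_derivative blinfun_apply (gd y) (z - y)) (at 0)"
    unfolding has_field_derivative_def by (simp add: blinfun.scaleR_right mult_commute_abs)
  then have "(?q \<longlongrightarrow> blinfun_apply (gd y) (z - y)) (at_right 0)"
    unfolding DERIV_def by (simp add: filterlim_at_split)
  moreover have "\<forall>\<^sub>F t in at_right 0. H y - H z + blinfun_apply (gd x) (z - y) \<le> ?q t"
  proof -
    have "H y - H z + blinfun_apply (gd x) (z - y) \<le> ?q t" if t: "0 < t" "t < 1" for t
    proof -
      let ?w = "y + t *\<^sub>R (z - y)"
      have w: "?w = (1 - t) *\<^sub>R y + t *\<^sub>R z"
        by (simp add: algebra_simps)
      have "?w \<in> Q"
        unfolding w using convex_on_imp_convex[OF H] y z t by (intro convexD) auto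
      then have "H y + bregman d gd x y \<le> H ?w + bregman d gd x ?w"
        by (rule min)
      also have "H ?w \<le> (1 - t) * H y + t * H z"
        unfolding w using convex_onD[OF H, of t y z] y z t by simp
      also have "bregman d gd x ?w
          = bregman d gd x y + (d ?w - d y) - t * blinfun_apply (gd x) (z - y)"
        by (simp add: bregman_def blinfun.diff_right blinfun.add_right blinfun.scaleR_right
            algebra_simps)
      finally have "t * (H y - H z + blinfun_apply (gd x) (z - y)) \<le> d ?w - d y"
        by (simp add: algebra_simps)
      then show ?thesis
        using t by (simp add: field_simps)
    qed
    then show ?thesis
      by (intro eventually_mono[OF eventually_at_right_real[of 0 1]]) auto
  qed
  ultimately have "H y - H z + blinfun_apply (gd x) (z - y) \<le> blinfun_apply (gd y) (z - y)"
    by (intro tendsto_lowerbound[of ?q]) auto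
  then show ?thesis
    using bregman_three_point_eq[of d gd x z y] by (simp add: blinfun.diff_left)
qed

section \<open>Lower semicontinuity and lower bounds\<close>

text \<open>A sublevel set is a horizontal slice of the epigraph, hence closed in the whole space,
  and \<open>y\<close> lies in its open complement. This is lower semicontinuity relative to
  \<open>S\<close>.\<close>

lemma closed_epigraph_eventually_less:
  fixes f :: "'a::real_normed_vector \<Rightarrow> real"
  assumes "closed (epigraph S f)" "y \<in> S" "c < f y"
  shows "\<forall>\<^sub>F z in at y within S. c < f z"
proof -
  have "{z \<in> S. f z \<le> c} = (\<lambda>z. (z, c)) -` epigraph S f"
    by (auto simp: epigraph_def)
  moreover have "closed ((\<lambda>z. (z, c)) -` epigraph S f)"
    using assms(1) by (intro closed_vimage continuous_intros)
  ultimately have "open (- {z \<in> S. f z \<le> c})"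
    by (simp only: open_Compl)
  then have "\<forall>\<^sub>F z in at y within S. z \<in> - {z \<in> S. f z \<le> c}"
    using assms by (intro topological_tendstoD[OF tendsto_ident_at]) auto
  moreover have "\<forall>\<^sub>F z in at y within S. z \<in> S"
    by (simp add: eventually_at_filter)
  ultimately show ?thesis
    by eventually_elim auto
qed

lemma eventually_within_ball:
  fixes y :: "'a::metric_space"
  assumes "\<forall>\<^sub>F z in at y within Q. P z" "P y"
  obtains r where "r > 0" "\<And>z. z \<in> Q \<Longrightarrow> dist z y < r \<Longrightarrow> P z"
  using assms unfolding eventually_at by metis

text \<open>Contracting a bounded \<open>Q\<close> towards \<open>y\<close> by a fixed factor
  \<open>s\<close> moves every point into a ball where \<open>G\<close> exceeds \<open>c\<close>;
  convexity carries this bound back to the original point.\<close>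

lemma convex_on_bounded_below:
  fixes G :: "'a::real_normed_vector \<Rightarrow> real"
  assumes G: "convex_on Q G" and bdd: "bounded Q" and y: "y \<in> Q"
    and near: "\<forall>\<^sub>F z in at y within Q. c < G z" "c < G y"
  obtains M where "\<And>z. z \<in> Q \<Longrightarrow> M \<le> G z"
proof -
  obtain r where r: "r > 0" "\<And>z. z \<in> Q \<Longrightarrow> dist z y < r \<Longrightarrow> c < G z"
    using eventually_within_ball[OF near] by metis
  obtain R where R: "\<And>z. z \<in> Q \<Longrightarrow> dist y z \<le> R"
    using bdd by (auto simp: bounded_any_center[of _ y])
  have "R \<ge> 0"
    using R[OF y] by simp
  \<comment> \<open>\<open>R + 1\<close> keeps the divisor positive when \<open>R = 0\<close>; the
    factor 1/2 makes the contracted distance strictly smaller than \<open>r\<close>.\<close>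
  define s where "s = min 1 (r / 2 / (R + 1))"
  have s: "0 < s" "s \<le> 1" "s \<le> r / 2 / (R + 1)"
    using r(1) \<open>R \<ge> 0\<close> by (auto simp: s_def)
  from s(3) have "s * (R + 1) \<le> r / 2"
    using \<open>R \<ge> 0\<close> by (subst (asm) pos_le_divide_eq) auto
  then have "s * (R + 1) < r"
    using r(1) by linarith
  have "G y - (G y - c) / s \<le> G z" if z: "z \<in> Q" for z
  proof -
    let ?w = "(1 - s) *\<^sub>R y + s *\<^sub>R z"
    have "?w \<in> Q"
      using convex_on_imp_convex[OF G] y z s by (intro convexD) auto
    moreover have "?w - y = s *\<^sub>R (z - y)"
      by (simp add: algebra_simps)
    then have "dist ?w y = s * dist y z"
      using s by (simp add: dist_norm norm_minus_commute)
    moreover have "s * dist y z \<le> s * (R + 1)"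
      using R[OF z] s by (intro mult_left_mono) auto
    ultimately have "c < G ?w"
      using r(2) \<open>s * (R + 1) < r\<close> by simp
    also have "G ?w \<le> (1 - s) * G y + s * G z"
      using convex_onD[OF G, of s y z] y z s by simp
    finally show ?thesis
      using s by (simp add: field_simps)
  qed
  then show ?thesis
    using that by blast
qed

text \<open>The quadratic term dominates a small multiple of \<open>W\<close> away from \<open>y\<close>, while near \<open>y\<close>
  semicontinuity keeps \<open>W\<close> positive.\<close>
lemma quadratic_absorbs_perturbation:
  fixes W :: "'a::real_normed_vector \<Rightarrow> real"
  assumes a: "0 < a" and lower: "\<And>z. z \<in> Q \<Longrightarrow> M \<le> W z"
    and near: "\<forall>\<^sub>F z in at y within Q. c < W z" and c: "0 < c" "c < W y"
  obtains t where "0 < t" "t \<le> 1/2"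
    "\<And>z. z \<in> Q \<Longrightarrow> t * c \<le> t * W z + a * (norm (z - y))\<^sup>2"
proof -
  obtain r where r: "r > 0" "\<And>z. z \<in> Q \<Longrightarrow> dist z y < r \<Longrightarrow> c < W z"
    using eventually_within_ball[OF near] c by metis
  \<comment> \<open>The second bound makes the quadratic term at distance at least \<open>r\<close>
    outweigh \<open>t * (c + \<bar>M\<bar>)\<close>; the bound 1/2 later keeps \<open>1 - t\<close>
    at least 1/2.\<close>
  define t where "t = min (1/2) (a * r\<^sup>2 / (c + \<bar>M\<bar>))"
  have "0 < a * r\<^sup>2 / (c + \<bar>M\<bar>)"
    using r(1) a c by (intro divide_pos_pos mult_pos_pos) auto
  then have t: "0 < t" "t \<le> 1/2" "t \<le> a * r\<^sup>2 / (c + \<bar>M\<bar>)"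
    unfolding t_def by linarith+
  from t(3) have t': "t * (c + \<bar>M\<bar>) \<le> a * r\<^sup>2"
    using c by (subst (asm) pos_le_divide_eq) auto
  have "t * c \<le> t * W z + a * (norm (z - y))\<^sup>2" if z: "z \<in> Q" for z
  proof (cases "dist z y < r")
    case True
    then have "t * c \<le> t * W z"
      using r(2)[OF z] t by simp
    moreover have "0 \<le> a * (norm (z - y))\<^sup>2"
      using a by simp
    ultimately show ?thesis
      by linarith
  next
    case False
    then have "r\<^sup>2 \<le> (norm (z - y))\<^sup>2"
      using r(1) by (simp add: dist_norm)
    then have "a * r\<^sup>2 \<le> a * (norm (z - y))\<^sup>2"
      using a by simp
    moreover have "t * (- \<bar>M\<bar>) \<le> t * W z"
      using lower[OF z] t by (intro mult_left_mono) auto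
    ultimately show ?thesis
      using t' by (simp add: algebra_simps)
  qed
  with t that show ?thesis
    by blast
qed

section \<open>Optimality of the multiplier\<close>

text \<open>Hypothesis \<open>opt\<close> says that \<open>l\<close> minimizes the dual function,
  the supremum of \<open>- (l' * G z) - b z\<close> over \<open>Q\<close>, phrased through upper
  bounds \<open>u\<close>. Were a conclusion false, raising or shrinking \<open>l\<close> slightly
  would lower the dual value: quadratic growth keeps competitors far from \<open>y\<close> harmless,
  so the dual function is never differentiated.\<close>

lemma complementary_slackness:
  fixes G b :: "'a::real_normed_vector \<Rightarrow> real"
  assumes l: "0 \<le> l" and y: "y \<in> Q"
    and bdd: "bounded Q" and G: "convex_on Q G"
    and G_lsc: "\<And>c. c < G y \<Longrightarrow> \<forall>\<^sub>F z in at y within Q. c < G z"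
    and b_nonneg: "\<And>z. z \<in> Q \<Longrightarrow> 0 \<le> b z"
    and b_lsc: "\<And>c. c < b y \<Longrightarrow> \<forall>\<^sub>F z in at y within Q. c < b z"
    and growth: "\<And>z. z \<in> Q \<Longrightarrow> l * G y + b y + 1/2 * (norm (z - y))\<^sup>2 \<le> l * G z + b z"
    and opt: "\<And>l' u. 0 \<le> l' \<Longrightarrow> (\<And>z. z \<in> Q \<Longrightarrow> - (l' * G z) - b z \<le> u)
                \<Longrightarrow> - (l * G y) - b y \<le> u"
  shows "G y \<le> 0" and "l * G y = 0"
proof -
  show le: "G y \<le> 0"
  proof (rule ccontr)
    assume "\<not> G y \<le> 0"
    then have c: "0 < G y / 2" "G y / 2 < G y"
      by auto
    obtain M where M: "\<And>z. z \<in> Q \<Longrightarrow> M \<le> G z"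
      using convex_on_bounded_below[OF G bdd y G_lsc[OF c(2)] c(2)] by metis
    obtain t where t: "0 < t"
      "\<And>z. z \<in> Q \<Longrightarrow> t * (G y / 2) \<le> t * G z + 1/2 * (norm (z - y))\<^sup>2"
      using quadratic_absorbs_perturbation[OF _ M G_lsc[OF c(2)] c, of "1/2"] by auto
    \<comment> \<open>The constraint is violated at \<open>y\<close>, so the larger multiplier
      \<open>l + t\<close> gives a strictly smaller dual value.\<close>
    have "- (l * G y) - b y \<le> - (l * G y) - b y - t * (G y / 2)"
    proof (rule opt)
      show "0 \<le> l + t"
        using l t by simp
      show "- ((l + t) * G z) - b z \<le> - (l * G y) - b y - t * (G y / 2)" if "z \<in> Q" for z
        using growth[OF that] t(2)[OF that] by (simp add: algebra_simps)
    qed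
    then show False
      using mult_pos_pos[OF t(1) c(1)] by linarith
  qed
  show "l * G y = 0"
  proof (rule ccontr)
    assume "l * G y \<noteq> 0"
    then have "l * G y < 0"
      using mult_nonneg_nonpos[OF l le] by linarith
    \<comment> \<open>\<open>W\<close> is the excess of \<open>b\<close> over the minimal value
      \<open>l * G y + b y\<close>; hence \<open>W y = - (l * G y)\<close>, and \<open>c\<close> is
      half of it.\<close>
    define c where "c = - (l * G y) / 2"
    define W where "W z = b z - (l * G y + b y)" for z
    have c: "0 < c" "c < W y"
      using \<open>l * G y < 0\<close> by (auto simp: c_def W_def)
    have near: "\<forall>\<^sub>F z in at y within Q. c < W z"
      using b_lsc[of "c + (l * G y + b y)"] c by (simp add: W_def algebra_simps)
    have M: "- (l * G y + b y) \<le> W z" if "z \<in> Q" for z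
      using b_nonneg[OF that] by (simp add: W_def)
    obtain t where t: "0 < t" "t \<le> 1/2"
      "\<And>z. z \<in> Q \<Longrightarrow> t * c \<le> t * W z + 1/4 * (norm (z - y))\<^sup>2"
      using quadratic_absorbs_perturbation[OF _ M near c, of "1/4"] by auto
    have "- (l * G y) - b y \<le> - (l * G y) - b y - t * c"
    proof (rule opt)
      show "0 \<le> (1 - t) * l"
        using l t by simp
      fix z assume z: "z \<in> Q"
      \<comment> \<open>With the multiplier \<open>(1 - t) * l\<close>, the excess at
        \<open>z\<close> over the value at \<open>y\<close> splits into this right-hand side plus
        \<open>t * W z\<close>. As \<open>1 - t\<close> is at least 1/2, half of the growth term
        survives, which explains the coefficient 1/4 above.\<close>
      have "(1/2) * (1/2 * (norm (z - y))\<^sup>2) \<le> (1 - t) * (l * G z + b z - (l * G y + b y))"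
        using growth[OF z] t by (intro mult_mono) auto
      then show "- ((1 - t) * l * G z) - b z \<le> - (l * G y) - b y - t * c"
        using t(3)[OF z] by (simp add: W_def algebra_simps)
    qed
    then show False
      using mult_pos_pos[OF t(1) c(1)] by linarith
  qed
qed

section \<open>Convexity and semicontinuity of the linearized constraint\<close>

lemma convex_on_Max:
  assumes "finite I" "I \<noteq> {}" "\<And>i. i \<in> I \<Longrightarrow> convex_on Q (f i)"
  shows "convex_on Q (\<lambda>x. Max ((\<lambda>i. f i x) ` I))"
proof (rule convex_onI)
  show "convex Q"
    using assms by (auto intro: convex_on_imp_convex)
  fix t :: real and u v
  assume t: "0 < t" "t < 1" and uv: "u \<in> Q" "v \<in> Q"
  have "f i ((1 - t) *\<^sub>R u + t *\<^sub>R v)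
      \<le> (1 - t) * Max ((\<lambda>i. f i u) ` I) + t * Max ((\<lambda>i. f i v) ` I)" if i: "i \<in> I" for i
  proof -
    have "f i ((1 - t) *\<^sub>R u + t *\<^sub>R v) \<le> (1 - t) * f i u + t * f i v"
      using convex_onD[OF assms(3)[OF i], of t u v] t uv by simp
    also have "\<dots> \<le> (1 - t) * Max ((\<lambda>i. f i u) ` I) + t * Max ((\<lambda>i. f i v) ` I)"
      using assms i t by (intro add_mono mult_left_mono Max_ge) auto
    finally show ?thesis .
  qed
  then show "Max ((\<lambda>i. f i ((1 - t) *\<^sub>R u + t *\<^sub>R v)) ` I)
      \<le> (1 - t) * Max ((\<lambda>i. f i u) ` I) + t * Max ((\<lambda>i. f i v) ` I)"
    using assms by simp
qed

lemma convex_on_lin_model: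
  assumes "1 \<le> m" "convex Q"
  shows "convex_on Q (lin_model m f f' xb)"
  unfolding lin_model_def
proof (rule convex_on_Max)
  fix i
  show "convex_on Q (\<lambda>x. f i xb + blinfun_apply (f' i xb) (x - xb))"
    using assms(2)
    by (intro convex_onI)
      (simp_all add: blinfun.diff_right blinfun.add_right blinfun.scaleR_right algebra_simps)
qed (use assms in auto)

text \<open>One affine piece already exceeds \<open>c\<close> at \<open>y\<close>; it does so nearby
  by continuity, and the maximum dominates it.\<close>

lemma lin_model_lsc:
  assumes "1 \<le> m" "c < lin_model m f f' xb y"
  shows "\<forall>\<^sub>F z in at y within Q. c < lin_model m f f' xb z"
proof -
  have *: "finite ((\<lambda>i. g i) ` {1..m})" "((\<lambda>i. g i) ` {1..m}) \<noteq> {}" for g :: "nat \<Rightarrow> real"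
    using assms by auto
  obtain i where i: "i \<in> {1..m}" "c < f i xb + blinfun_apply (f' i xb) (y - xb)"
    using assms(2) unfolding lin_model_def Max_gr_iff[OF *] by auto
  have "((\<lambda>z. f i xb + blinfun_apply (f' i xb) (z - xb))
      \<longlongrightarrow> f i xb + blinfun_apply (f' i xb) (y - xb)) (at y within Q)"
    by (intro tendsto_intros)
  then have "\<forall>\<^sub>F z in at y within Q. c < f i xb + blinfun_apply (f' i xb) (z - xb)"
    using i(2) by (rule order_tendstoD)
  then show ?thesis
    by (rule eventually_mono) (use i(1) in \<open>auto simp: lin_model_def intro: less_le_trans Max_ge\<close>)
qed

lemma lin_model_le:
  assumes "1 \<le> m"
    and "\<And>i. i \<in> {1..m} \<Longrightarrow> f i xb + blinfun_apply (f' i xb) (z - xb) \<le> f i z + e"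
  shows "lin_model m f f' xb z \<le> Max ((\<lambda>i. f i z) ` {1..m}) + e"
proof -
  have "f i xb + blinfun_apply (f' i xb) (z - xb) \<le> Max ((\<lambda>i. f i z) ` {1..m}) + e"
    if "i \<in> {1..m}" for i
  proof -
    have "f i z \<le> Max ((\<lambda>i. f i z) ` {1..m})"
      using that by (intro Max_ge) auto
    then show ?thesis
      using assms(2)[OF that] by linarith
  qed
  then show ?thesis
    using assms(1) by (auto simp: lin_model_def)
qed

lemma convex_on_lin_model_add:
  assumes "1 \<le> m" "closed_convex_on S \<psi>" "Q \<subseteq> S" "convex Q"
  shows "convex_on Q (\<lambda>z. lin_model m f f' xb z + \<psi> z)"
  using assms by (auto simp: closed_convex_on_def intro!: convex_on_lin_model
      intro: convex_on_subset)

lemma lin_model_add_lsc: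
  assumes m: "1 \<le> m" and \<psi>: "closed_convex_on S \<psi>" "Q \<subseteq> S" and y: "y \<in> Q"
    and c: "c < lin_model m f f' xb y + \<psi> y"
  shows "\<forall>\<^sub>F z in at y within Q. c < lin_model m f f' xb z + \<psi> z"
proof -
  \<comment> \<open>The gap above \<open>c\<close> is shared equally between the two semicontinuous
    summands.\<close>
  define e where "e = (lin_model m f f' xb y + \<psi> y - c) / 2"
  have e: "0 < e" "c = (lin_model m f f' xb y - e) + (\<psi> y - e)"
    using c by (auto simp: e_def field_simps)
  have "\<forall>\<^sub>F z in at y within S. \<psi> y - e < \<psi> z"
    using \<psi> y e by (intro closed_epigraph_eventually_less) (auto simp: closed_convex_on_def)
  then have "\<forall>\<^sub>F z in at y within Q. \<psi> y - e < \<psi> z"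
    using \<psi>(2) by (meson at_le filter_leD)
  moreover have "\<forall>\<^sub>F z in at y within Q. lin_model m f f' xb y - e < lin_model m f f' xb z"
    using m e by (intro lin_model_lsc) auto
  ultimately show ?thesis
    by eventually_elim (use e in linarith)
qed

lemma bregman_tendsto:
  assumes "prox_function U d gd" "y \<in> U"
  shows "(bregman d gd x \<longlongrightarrow> bregman d gd x y) (at y within Q)"
proof -
  have "(d has_derivative blinfun_apply (gd y)) (at y)"
    using assms by (auto simp: prox_function_def)
  then have "isCont d y"
    by (rule has_derivative_continuous)
  then have "(d \<longlongrightarrow> d y) (at y within Q)"
    by (simp add: continuous_at_imp_continuous_at_within continuous_within[symmetric])
  then have "((\<lambda>z. d z - d x - blinfun_apply (gd x) (z - x))
      \<longlongrightarrow> d y - d x - blinfun_apply (gd x) (y - x)) (at y within Q)"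
    by (intro tendsto_intros)
  then show ?thesis
    by (simp add: bregman_def[abs_def])
qed

section \<open>The feasibility step\<close>

lemma feas_step_in:
  "feas_step Q m f f' \<psi> d gd xb y \<Longrightarrow> y \<in> Q"
  by (auto simp: feas_step_def is_arg_max_def)

text \<open>Subtracting \<open>l * constr m f \<psi> xb\<close> leaves the Lagrange dual of
  minimizing \<open>bregman d gd xb\<close> over the points of \<open>Q\<close> with
  \<open>lin_model + \<psi>\<close> at most 0. So \<open>y\<close> is the Bregman projection of
  \<open>xb\<close> onto this set, and the descent is the Pythagorean inequality of that
  projection.\<close>

lemma feas_step_properties:
  assumes m: "1 \<le> m" and \<psi>: "closed_convex_on S \<psi>"
    and Q: "Q \<subseteq> S" "convex Q" "bounded Q"
    and prox: "prox_function U d gd" "Q \<subseteq> U"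
    and xb: "xb \<in> Q"
    and step: "feas_step Q m f f' \<psi> d gd xb y"
  shows feas_step_model_nonpos: "lin_model m f f' xb y + \<psi> y \<le> 0"
    and feas_step_descent: "\<And>z. z \<in> Q \<Longrightarrow> lin_model m f f' xb z + \<psi> z \<le> 0
      \<Longrightarrow> bregman d gd y z \<le> bregman d gd xb z - bregman d gd xb y"
proof -
  define G where "G z = lin_model m f f' xb z + \<psi> z" for z
  define b where "b = bregman d gd xb"
  obtain l where lmin: "is_arg_min (\<lambda>l. feas_value Q m f f' \<psi> d gd xb l - l * constr m f \<psi> xb)
        (\<lambda>l. 0 \<le> l) l"
    and ymax: "is_arg_max (feas_obj m f f' \<psi> d gd xb l) (\<lambda>x. x \<in> Q) y"
    using step by (auto simp: feas_step_def)
  have l: "0 \<le> l" and y: "y \<in> Q"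
    using lmin ymax by (auto simp: is_arg_min_def is_arg_max_def)
  have obj: "feas_obj m f f' \<psi> d gd xb l z = l * constr m f \<psi> xb + (- (l * G z) - b z)" for l z
    by (simp add: feas_obj_def G_def b_def algebra_simps)
  have ymin: "l * G y + b y \<le> l * G w + b w" if "w \<in> Q" for w
    using ymax that by (force simp: is_arg_max_def obj not_less)
  have convG: "convex_on Q G"
    unfolding G_def using m \<psi> Q by (intro convex_on_lin_model_add)
  have three: "l * G y + b y + bregman d gd y z \<le> l * G z + b z" if "z \<in> Q" for z
    unfolding b_def
    by (rule bregman_three_point[OF prox _ y that])
      (use l convG ymin in \<open>auto simp: b_def\<close>)
  have value_l: "feas_value Q m f f' \<psi> d gd xb l = l * constr m f \<psi> xb + (- (l * G y) - b y)"
    unfolding feas_value_def obj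
    by (rule cSup_eq_maximum) (use y ymin in force)+
  \<comment> \<open>The supremum for \<open>l\<close> is attained at \<open>y\<close>, and any upper
    bound \<open>u\<close> for \<open>l'\<close> bounds the supremum for \<open>l'\<close>;
    minimality of \<open>l\<close> compares the two.\<close>
  have opt: "- (l * G y) - b y \<le> u"
    if l': "0 \<le> l'" and u: "\<And>z. z \<in> Q \<Longrightarrow> - (l' * G z) - b z \<le> u" for l' u
  proof -
    have "feas_value Q m f f' \<psi> d gd xb l' \<le> l' * constr m f \<psi> xb + u"
      unfolding feas_value_def obj using y u by (intro cSUP_least) auto
    then show ?thesis
      using lmin l' value_l by (force simp: is_arg_min_def not_less)
  qed
  have slack: "G y \<le> 0" "l * G y = 0"
  proof -
    note cs = complementary_slackness[OF l y Q(3) convG, of b]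
    have lsc: "\<forall>\<^sub>F z in at y within Q. c < G z" if "c < G y" for c
      using that m \<psi> Q(1) y unfolding G_def by (intro lin_model_add_lsc)
    have b_lsc: "\<forall>\<^sub>F z in at y within Q. c < b z" if "c < b y" for c
      using bregman_tendsto[OF prox(1), of y xb Q] prox(2) y that
      unfolding b_def by (auto intro: order_tendstoD)
    have nonneg: "0 \<le> b z" if "z \<in> Q" for z
      using prox_function_bregman_nonneg[OF prox(1), of xb z] prox(2) xb that
      by (auto simp: b_def)
    have growth: "l * G y + b y + 1/2 * (norm (z - y))\<^sup>2 \<le> l * G z + b z" if "z \<in> Q" for z
      using three[OF that] prox_function_bregman_ge[OF prox(1), of y z] prox(2) y that by force
    show "G y \<le> 0" "l * G y = 0"
      using cs[OF lsc nonneg b_lsc growth opt] by auto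
  qed
  show "lin_model m f f' xb y + \<psi> y \<le> 0"
    using slack by (simp add: G_def)
  show "bregman d gd y z \<le> bregman d gd xb z - bregman d gd xb y"
    if "z \<in> Q" "lin_model m f f' xb z + \<psi> z \<le> 0" for z
  proof -
    have "l * G z \<le> 0"
      using l that(2) by (simp add: G_def mult_nonneg_nonpos)
    then show ?thesis
      using three[OF that(1)] slack by (simp add: b_def)
  qed
qed

section \<open>The optimality step\<close>

lemma opt_step_in: "opt_step Q g d gd h y x \<Longrightarrow> x \<in> Q"
  by (auto simp: opt_step_def is_arg_max_def)

text \<open>The prescribed optimal value forces \<open>l\<close> times the slope of
  \<open>g y\<close> along the unit direction from \<open>x\<close> to \<open>y\<close> to be at
  least \<open>h\<close>. Together with \<open>loc\<close> this makes the linear gain at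
  \<open>z\<close> at least the square of \<open>h\<close>; the three-point inequality gives back
  only half of it.\<close>

lemma opt_step_descent:
  assumes Q: "convex Q" and prox: "prox_function U d gd" "Q \<subseteq> U"
    and y: "y \<in> Q" and z: "z \<in> Q" and h: "0 < h"
    and step: "opt_step Q g d gd h y x"
    and loc: "h \<le> blinfun_apply (g y) (y - z) /
      blinfun_apply (g y) ((y - x) /\<^sub>R norm (y - x))"
  shows "bregman d gd x z \<le> bregman d gd y z - 1/2 * h\<^sup>2"
proof -
  obtain l where l: "0 < l" and val: "opt_value Q g d gd y l = 1/2 * h\<^sup>2"
    and xmax: "is_arg_max (opt_obj g d gd y l) (\<lambda>z. z \<in> Q) x"
    using step by (auto simp: opt_step_def)
  have x: "x \<in> Q"
    using xmax by (simp add: is_arg_max_def)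
  have max: "opt_obj g d gd y l w \<le> opt_obj g d gd y l x" if "w \<in> Q" for w
    using xmax that by (force simp: is_arg_max_def not_less)
  have "opt_value Q g d gd y l = opt_obj g d gd y l x"
    unfolding opt_value_def by (rule cSup_eq_maximum) (use x max in auto)
  then have lx: "l * blinfun_apply (g y) (y - x) = 1/2 * h\<^sup>2 + bregman d gd y x"
    using val unfolding opt_obj_def by linarith
  define n where "n = norm (y - x)"
  have "1/2 * n\<^sup>2 \<le> bregman d gd y x"
    using prox_function_bregman_ge[OF prox(1), of y x] prox(2) x y
    by (auto simp: n_def norm_minus_commute)
  \<comment> \<open>This bounds \<open>h * n\<close> by half the sum of the squares of
    \<open>h\<close> and \<open>n\<close>, which \<open>lx\<close> and strong convexity
    provide.\<close>
  moreover have "0 \<le> (h - n)\<^sup>2"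
    by simp
  ultimately have hn: "h * n \<le> l * blinfun_apply (g y) (y - x)"
    unfolding lx by (simp add: power2_eq_square algebra_simps)
  \<comment> \<open>If \<open>x = y\<close>, then \<open>lx\<close> would equate 0 with half the
    square of \<open>h\<close>. Hence the direction in \<open>loc\<close> is a genuine unit
    vector.\<close>
  have n: "n > 0"
    using lx h by (auto simp: n_def)
  define q where "q = blinfun_apply (g y) ((y - x) /\<^sub>R n)"
  have "q = blinfun_apply (g y) (y - x) / n"
    unfolding q_def blinfun.scaleR_right by (simp add: divide_inverse mult.commute)
  then have q: "h \<le> l * q"
    using hn n by (simp add: pos_le_divide_eq)
  then have "0 < l * q"
    using h by linarith
  then have "0 < q"
    using l by (rule zero_less_mult_pos)
  then have "h * q \<le> blinfun_apply (g y) (y - z)"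
    using loc by (simp add: q_def n_def pos_le_divide_eq)
  then have "l * (h * q) \<le> l * blinfun_apply (g y) (y - z)"
    using l by (intro mult_left_mono) auto
  moreover have "h * h \<le> h * (l * q)"
    using q h by (intro mult_left_mono) auto
  ultimately have gain: "h\<^sup>2 \<le> l * blinfun_apply (g y) (y - z)"
    by (simp add: power2_eq_square algebra_simps)
  have "convex_on Q (\<lambda>w. - (l * blinfun_apply (g y) (y - w)))"
    using Q by (intro convex_onI)
      (simp_all add: blinfun.diff_right blinfun.add_right blinfun.scaleR_right algebra_simps)
  then have "- (l * blinfun_apply (g y) (y - x)) + bregman d gd y x + bregman d gd x z
      \<le> - (l * blinfun_apply (g y) (y - z)) + bregman d gd y z"
    by (rule bregman_three_point[OF prox _ x z]) (use max in \<open>simp add: opt_obj_def algebra_simps\<close>)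
  then show ?thesis
    using lx gain by linarith
qed

section \<open>Divergence delay and summation of the descent\<close>

text \<open>Divergence supplies a block starting at \<open>k\<close> whose sum reaches 1, so the
  \<open>LEAST\<close> in the definition has a witness and satisfies its own condition.\<close>

lemma divergence_delay_sum:
  assumes "filterlim (\<lambda>n. \<Sum>k<n. (\<tau> k)\<^sup>2) at_top sequentially"
  shows "1 \<le> (\<Sum>i=k..k + divergence_delay \<tau> k. (\<tau> i)\<^sup>2)"
proof -
  have "\<forall>\<^sub>F n in sequentially. (\<Sum>i<k. (\<tau> i)\<^sup>2) + 1 \<le> (\<Sum>i<n. (\<tau> i)\<^sup>2)"
    using assms by (auto simp: filterlim_at_top)
  then obtain n where n: "n > k" "(\<Sum>i<k. (\<tau> i)\<^sup>2) + 1 \<le> (\<Sum>i<n. (\<tau> i)\<^sup>2)"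
    using eventually_happens[OF eventually_conj[OF eventually_gt_at_top[of k]]]
    by (metis sequentially_bot)
  then obtain j where j: "n = Suc (k + j)"
    using less_imp_Suc_add by blast
  have "(\<Sum>i<n. (\<tau> i)\<^sup>2) = (\<Sum>i<k. (\<tau> i)\<^sup>2) + (\<Sum>i=k..k + j. (\<tau> i)\<^sup>2)"
    using sum.atLeastLessThan_concat[of 0 k n "\<lambda>i. (\<tau> i)\<^sup>2"] n(1)
    by (simp add: j lessThan_atLeast0 atLeastLessThanSuc_atLeastAtMost)
  with n(2) have "1 \<le> (\<Sum>i=k..k + j. (\<tau> i)\<^sup>2)"
    by simp
  then show ?thesis
    unfolding divergence_delay_def by (rule LeastI)
qed

lemma descent_sum:
  fixes V w :: "nat \<Rightarrow> real"
  assumes "K \<le> N" "\<And>k. K \<le> k \<Longrightarrow> k < N \<Longrightarrow> V (Suc k) \<le> V k - w k"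
  shows "V N \<le> V K - (\<Sum>k=K..<N. w k)"
  using assms
proof (induction N rule: dec_induct)
  case (step n)
  have "V n \<le> V K - (\<Sum>k=K..<n. w k)"
    using step.prems by (intro step.IH) simp
  moreover have "V (Suc n) \<le> V n - w n"
    using step.hyps by (intro step.prems) auto
  ultimately show ?case
    using step.hyps by simp
qed simp

section \<open>Convergence estimates for the method\<close>

theorem theorem3:
  fixes Q dom_psi dom_d :: "'a::real_normed_vector set"
    and dom_f :: "nat \<Rightarrow> 'a set"
    and m N :: nat
    and f :: "nat \<Rightarrow> 'a \<Rightarrow> real"
    and f' :: "nat \<Rightarrow> 'a \<Rightarrow> ('a \<Rightarrow>\<^sub>L real)"
    and \<psi> d :: "'a \<Rightarrow> real"
    and gd :: "'a \<Rightarrow> ('a \<Rightarrow>\<^sub>L real)"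
    and D :: real
    and \<tau> h :: "nat \<Rightarrow> real"
    and xs :: 'a
    and x y :: "nat \<Rightarrow> 'a"
  assumes fin_dim: "\<exists>B :: 'a set. finite B \<and> span B = UNIV"
    and m: "1 \<le> m"
    and psi: "closed_convex_on dom_psi \<psi>"
    and Q: "Q \<subseteq> dom_psi" "closed Q" "convex Q"
    and f_dom: "\<And>i. i \<le> m \<Longrightarrow> dom_psi \<subseteq> dom_f i"
    and f_cc: "\<And>i. i \<le> m \<Longrightarrow> closed_convex_on dom_psi (f i)"
    and f_sub: "\<And>i z. i \<in> {1..m} \<Longrightarrow> z \<in> Q \<Longrightarrow> is_subgradient (dom_f i) (f i) z (f' i z)"
    and f0_nz: "\<And>z. z \<in> Q \<Longrightarrow> f' 0 z \<noteq> 0"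
    and f0_sub: "\<And>z w. z \<in> Q \<Longrightarrow> w \<in> dom_f 0 \<Longrightarrow>
                   blinfun_apply (f' 0 z) (w - z) \<ge> 0 \<Longrightarrow> f 0 w \<ge> f 0 z"
    and prox: "prox_function dom_d d gd" "Q \<subseteq> dom_d"
    and D: "\<And>z w. z \<in> Q \<Longrightarrow> w \<in> Q \<Longrightarrow> bregman d gd z w < D"
    and sol: "is_solution Q m f \<psi> xs"
    and tau: "\<And>k. \<tau> (Suc k) \<le> \<tau> k" "\<And>k. 0 < \<tau> k"
    and tau_div: "filterlim (\<lambda>n. \<Sum>k<n. (\<tau> k)\<^sup>2) at_top sequentially"
    and h: "\<And>k. h k = sqrt (2 * D) * \<tau> k"
    and iter: "double_step_method Q m f f' \<psi> d gd h x y"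
    and N: "N \<ge> 1 + divergence_delay \<tau> 0"
  shows "finite (delay_set \<tau> N) \<and> delay_set \<tau> N \<noteq> {} \<and>
    (INF k \<in> opt_iterations d gd \<tau> h x y N. ereal (localization (f' 0) xs x y k))
      < ereal (h (delay_index \<tau> N)) \<and>
    (\<forall>\<nu> L. 0 \<le> \<nu> \<longrightarrow> \<nu> \<le> 1 \<longrightarrow> 0 < L \<longrightarrow>
       (\<forall>i\<in>{1..m}. hoelder_gradient Q (f i) (f' i) \<nu> L) \<longrightarrow>
       (\<forall>k \<in> opt_iterations d gd \<tau> h x y N.
          constr m f \<psi> (y k) \<le> L / (1 + \<nu>) * h (delay_index \<tau> N) powr (1 + \<nu>)))"
proof -
  let ?K = "delay_index \<tau> N" and ?b = "bregman d gd"
  \<comment> \<open>Finiteness and nonemptiness make the \<open>Max\<close> in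
    \<open>delay_index\<close> an actual maximum; the index 0 belongs to the set by the bound on
    \<open>N\<close>.\<close>
  have finK: "finite (delay_set \<tau> N)"
    by (rule finite_subset[of _ "{..N}"]) (auto simp: delay_set_def)
  have neK: "delay_set \<tau> N \<noteq> {}"
    using N by (auto simp: delay_set_def intro!: exI[of _ 0])
  have "?K \<in> delay_set \<tau> N"
    unfolding delay_index_def using finK neK by (rule Max_in)
  then have K: "?K + divergence_delay \<tau> ?K \<le> N - 1"
    by (simp add: delay_set_def)
  then have KN: "?K \<le> N"
    by simp
  have xsQ: "xs \<in> Q" and xs_feas: "constr m f \<psi> xs \<le> 0"
    using sol by (auto simp: is_solution_def is_arg_min_def)
  have Dpos: "0 < D"
    using D[OF xsQ xsQ] by simp
  have hpos: "0 < h k" for k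
    using Dpos tau(2) by (simp add: h)
  have "decseq \<tau>"
    using tau(1) by (simp add: decseq_Suc_iff)
  then have hmono: "h k \<le> h j" if "j \<le> k" for j k
    using that Dpos by (auto simp: h decseq_def)
  have breg_ge: "1/2 * (norm (w - z))\<^sup>2 \<le> ?b z w" if "z \<in> Q" "w \<in> Q" for z w
    using prox_function_bregman_ge[OF prox(1), of z w] prox(2) that by auto
  \<comment> \<open>Strong convexity bounds the squared distance to \<open>xs\<close> by twice the
    Bregman distance, hence by \<open>2 * D\<close>.\<close>
  have bdd: "bounded Q"
    unfolding bounded_def
  proof (intro exI ballI)
    fix z assume z: "z \<in> Q"
    have "(norm (z - xs))\<^sup>2 \<le> 2 * D"
      using breg_ge[OF xsQ z] D[OF xsQ z] by simp
    then show "dist xs z \<le> sqrt (2 * D)"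
      by (simp add: dist_norm norm_minus_commute real_le_rsqrt)
  qed
  have feas: "feas_step Q m f f' \<psi> d gd (x k) (y k)" for k
    using iter by (simp add: double_step_method_def)
  have yQ: "y k \<in> Q" for k
    using feas by (rule feas_step_in)
  have step: "if ?b (x k) (y k) \<ge> 1/2 * (h k)\<^sup>2 then x (Suc k) = y k
      else opt_step Q (f' 0) d gd (h k) (y k) (x (Suc k))" for k
    using iter unfolding double_step_method_def by blast
  have xQ: "x k \<in> Q" for k
  proof (cases k)
    case 0
    then show ?thesis
      using iter by (simp add: double_step_method_def)
  next
    case (Suc j)
    then show ?thesis
      using step[of j] yQ[of j] opt_step_in by (metis (full_types))
  qed
  \<comment> \<open>Subgradient linearizations lie below the constraints, so feasibility of
    \<open>xs\<close> passes to every model.\<close>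
  have model_xs: "lin_model m f f' (x k) xs + \<psi> xs \<le> 0" for k
  proof -
    have "xs \<in> dom_f i" if "i \<in> {1..m}" for i
      using f_dom[of i] that Q(1) xsQ by auto
    then have "lin_model m f f' (x k) xs \<le> Max ((\<lambda>i. f i xs) ` {1..m}) + 0"
      using m f_sub xQ by (intro lin_model_le) (auto simp: is_subgradient_def)
    then show ?thesis
      using xs_feas by (simp add: constr_def)
  qed
  have y_descent: "?b (y k) xs \<le> ?b (x k) xs - ?b (x k) (y k)" for k
    by (rule feas_step_descent[OF m psi Q(1,3) bdd prox xQ feas xsQ model_xs])
  have "(INF k \<in> opt_iterations d gd \<tau> h x y N. ereal (localization (f' 0) xs x y k))
      < ereal (h ?K)"
  \<comment> \<open>An infimum over the empty set is infinite, so the contradiction also rules out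
    that no optimality step occurs.\<close>
  proof (rule ccontr)
    assume "\<not> ?thesis"
    then have loc: "h ?K \<le> localization (f' 0) xs x y k"
      if "k \<in> opt_iterations d gd \<tau> h x y N" for k
      using that by (simp add: not_less le_INF_iff)
    \<comment> \<open>The decrease is half the square of \<open>h k\<close> in both branches: a
      passed test supplies it through the feasibility step, a failed one through the optimality
      step, since \<open>h k\<close> is at most \<open>h ?K\<close>.\<close>
    have "?b (x (Suc k)) xs \<le> ?b (x k) xs - D * (\<tau> k)\<^sup>2" if k: "?K \<le> k" "k < N" for k
    proof -
      have hk: "1/2 * (h k)\<^sup>2 = D * (\<tau> k)\<^sup>2"
        using Dpos by (simp add: h power_mult_distrib)
      show ?thesis
      proof (cases "?b (x k) (y k) \<ge> 1/2 * (h k)\<^sup>2")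
        case True
        then have "x (Suc k) = y k"
          using step[of k] by simp
        with True show ?thesis
          using y_descent[of k] hk by simp
      next
        case False
        have "k \<in> opt_iterations d gd \<tau> h x y N"
          using False k by (auto simp: opt_iterations_def)
        then have "h k \<le> localization (f' 0) xs x y k"
          using loc hmono[OF k(1)] by (meson order_trans)
        moreover have "opt_step Q (f' 0) d gd (h k) (y k) (x (Suc k))"
          using step[of k] False by simp
        ultimately have "?b (x (Suc k)) xs \<le> ?b (y k) xs - 1/2 * (h k)\<^sup>2"
          using opt_step_descent[OF Q(3) prox yQ xsQ hpos] by (simp add: localization_def)
        moreover have "0 \<le> ?b (x k) (y k)"
          using prox_function_bregman_nonneg[OF prox(1)] prox(2) xQ yQ by blast
        ultimately show ?thesis
          using y_descent[of k] hk by simp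
      qed
    qed
    then have "?b (x N) xs \<le> ?b (x ?K) xs - (\<Sum>k=?K..<N. D * (\<tau> k)\<^sup>2)"
      using KN by (intro descent_sum) auto
    \<comment> \<open>The block of the delay at \<open>?K\<close> ends at or before
      \<open>N - 1\<close>, which lies below \<open>N\<close> because \<open>N\<close> is
      positive.\<close>
    moreover have "1 \<le> (\<Sum>k=?K..<N. (\<tau> k)\<^sup>2)"
      by (rule order_trans[OF divergence_delay_sum[OF tau_div, of ?K]], rule sum_mono2)
        (use K N in auto)
    then have "D \<le> (\<Sum>k=?K..<N. D * (\<tau> k)\<^sup>2)"
      using Dpos by (simp add: sum_distrib_left[symmetric])
    moreover have "0 \<le> ?b (x N) xs"
      using prox_function_bregman_nonneg[OF prox(1)] prox(2) xQ xsQ by blast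
    ultimately show False
      using D[OF xQ[of ?K] xsQ] by linarith
  qed
  moreover have "constr m f \<psi> (y k) \<le> L / (1 + \<nu>) * h ?K powr (1 + \<nu>)"
    if \<nu>: "0 \<le> \<nu>" and L: "0 < L"
      and hg: "\<forall>i\<in>{1..m}. hoelder_gradient Q (f i) (f' i) \<nu> L"
      and k: "k \<in> opt_iterations d gd \<tau> h x y N" for \<nu> L k
  proof -
    define e where "e = L / (1 + \<nu>) * norm (y k - x k) powr (1 + \<nu>)"
    \<comment> \<open>The failed test bounds the Bregman distance by half the square of
      \<open>h k\<close>, so the feasibility step was short and the Hoelder error \<open>e\<close>
      of the model is small.\<close>
    have "(norm (y k - x k))\<^sup>2 < (h k)\<^sup>2"
      using breg_ge[OF xQ yQ, of k k] k by (simp add: opt_iterations_def)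
    then have "norm (y k - x k) \<le> h k"
      using hpos[of k] by (simp add: power2_less_imp_less less_imp_le)
    also have "\<dots> \<le> h ?K"
      using k by (intro hmono) (simp add: opt_iterations_def)
    finally have e: "e \<le> L / (1 + \<nu>) * h ?K powr (1 + \<nu>)"
      unfolding e_def using \<nu> L by (intro mult_left_mono powr_mono2) auto
    have "f i (y k) \<le> lin_model m f f' (x k) (y k) + e" if i: "i \<in> {1..m}" for i
    proof -
      have "f i (y k) \<le> f i (x k) + blinfun_apply (f' i (x k)) (y k - x k) + e"
        using hg i xQ yQ by (auto simp: hoelder_gradient_def e_def)
      also have "f i (x k) + blinfun_apply (f' i (x k)) (y k - x k) \<le> lin_model m f f' (x k) (y k)"
        unfolding lin_model_def using i by (intro Max_ge) auto
      finally show ?thesis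
        by simp
    qed
    then have "Max ((\<lambda>i. f i (y k)) ` {1..m}) \<le> lin_model m f f' (x k) (y k) + e"
      using m by simp
    then have "constr m f \<psi> (y k) \<le> e"
      using feas_step_model_nonpos[OF m psi Q(1,3) bdd prox xQ feas, of k]
      by (simp add: constr_def)
    with e show ?thesis
      by simp
  qed
  ultimately show ?thesis
    using finK neK by blast
qed

end
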